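(* Let $D(x)=\mathbf{W}x$ be a linear operator on $\mathbb{R}^n$, where $\mathbf{W}\in\mathbb{R}^{n\times n}$ is diagonalizable with all eigenvalues in $[0,1]$. Let $\mathbf{V}\in\mathbb{R}^{n\times n}$ be an eigen matrix of $\mathbf{W}$, i.e., the columns of $\mathbf{V}$ are linearly independent eigenvectors of $\mathbf{W}$. Define the inner product $\langle x,y\rangle=(\mathbf{V}^{-1}x)^\top(\mathbf{V}^{-1}y)$ on $\mathbb{R}^n$. Then: (a) $D$ is the proximal operator on $(\mathbb{R}^n,\langle\cdot,\cdot\rangle)$ of some closed, proper and convex function $g_D:\mathbb{R}^n\to\mathbb{R}\cup\{\infty\}$. (b) $D$ is $\theta$-averaged on $(\mathbb{R}^n,\langle\cdot,\cdot\rangle)$ for every $\theta\in[1/2,1)$. (c) The restriction of $g_D$ to the range space $\mathcal{R}(\mathbf{W})$ is real-valued (and hence continuous). (d) Let $\rho>0$. For $f:\mathbb{R}^n\to\mathbb{R}$ differentiable (respectively, convex), the iterates of PnP-ISTA (respectively, PnP-ADMM) with denoiser $D$, data-fidelity $f$ and parameter $\rho$ in $(\mathbb{R}^n,\langle\cdot,\cdot\rangle)$ are identical to the iterates of ISTA (respectively, ADMM) with parameter $\rho$ in $(\mathbb{R}^n,\langle\cdot,\cdot\rangle)$ (with the same initialization) applied to the optimization problem $\min_{x\in\mathbb{R}^n} f(x)+\rho\, g_D(x)$.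
   Context: Let $\|\cdot\|$ be the norm induced by $\langle\cdot,\cdot\rangle$; $I$ is the identity operator. Proximal operator on $(\mathbb{R}^n,\langle\cdot,\cdot\rangle)$: for closed, proper, convex $h:\mathbb{R}^n\to\mathbb{R}\cup\{\infty\}$, $\mathrm{Prox}_h(x)=\arg\min_{y}\ \tfrac12\|y-x\|^2+h(y)$. Averaged: $A$ is $\theta$-averaged, $\theta\in(0,1)$, if $A=(1-\theta)I+\theta T$ with $\|T(x)-T(y)\|\le\|x-y\|$ for all $x,y$. Gradient: $\nabla f(x)$ is the unique vector such that the derivative $L(x)$ of $f$ at $x$ satisfies $L(x)(h)=\langle\nabla f(x),h\rangle$ for all $h$. ISTA with parameter $\rho$ for minimizing $f+g$: $z_{k+1}=x_k-\rho^{-1}\nabla f(x_k)$, $x_{k+1}=\mathrm{Prox}_{\rho^{-1}g}(z_{k+1})$, $x_0\in\mathbb{R}^n$ arbitrary. ADMM with parameter $\rho$ for minimizing $f+g$: $x_{k+1}=\mathrm{Prox}_{\rho^{-1}f}(y_k-z_k)$, $y_{k+1}=\mathrm{Prox}_{\rho^{-1}g}(x_{k+1}+z_k)$, $z_{k+1}=z_k+x_{k+1}-y_{k+1}$, $y_0,z_0\in\mathbb{R}^n$ arbitrary. PnP-ISTA: $x_{k+1}=D(x_k-\rho^{-1}\nabla f(x_k))$. PnP-ADMM: $x_{k+1}=\mathrm{Prox}_{\rho^{-1}f}(y_k-z_k)$, $y_{k+1}=D(x_{k+1}+z_k)$, $z_{k+1}=z_k+x_{k+1}-y_{k+1}$.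 *)

theory Defs
  imports "HOL-Analysis.Analysis"
begin

section \<open>Eigenvalues and diagonalizability of real matrices\<close>

definition eigenvector :: "real^'n^'n \<Rightarrow> real^'n \<Rightarrow> real \<Rightarrow> bool" where
  "eigenvector A v l \<longleftrightarrow> v \<noteq> 0 \<and> A *v v = l *\<^sub>R v"

definition eigenvalue :: "real^'n^'n \<Rightarrow> real \<Rightarrow> bool" where
  "eigenvalue A l \<longleftrightarrow> (\<exists>v. eigenvector A v l)"

definition diagonal_matrix :: "real^'n^'n \<Rightarrow> bool" where
  "diagonal_matrix A \<longleftrightarrow> (\<forall>i j. i \<noteq> j \<longrightarrow> A $ i $ j = 0)"

text \<open>Diagonalizability is over the reals, so that all complex eigenvalues of such a matrix
  are real and \<^const>\<open>eigenvalue\<close> captures all of them.\<close>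

definition diagonalizable :: "real^'n^'n \<Rightarrow> bool" where
  "diagonalizable A \<longleftrightarrow>
     (\<exists>P L :: real^'n^'n. invertible P \<and> diagonal_matrix L \<and> A = P ** L ** matrix_inv P)"

text \<open>Linear independence is that of the family of columns: \<^const>\<open>columns\<close> is a set and
  hides repeated columns, whence the injectivity condition.\<close>

definition eigen_matrix :: "real^'n^'n \<Rightarrow> real^'n^'n \<Rightarrow> bool" where
  "eigen_matrix A V \<longleftrightarrow>
     (\<forall>i. \<exists>l. eigenvector A (column i V) l) \<and>
     inj (\<lambda>i. column i V) \<and> independent (columns V)"


section \<open>Notions relative to an inner product\<close>

text \<open>Below, \<open>ip\<close> is an arbitrary inner product, not the standard one of the type
  \<^typ>\<open>real^'n\<close>. Convergence, continuity, closedness and differentiability do not depend on this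
  choice, because all norms on a finite-dimensional space are equivalent; norms, gradients and
  proximal operators do.\<close>

type_synonym 'n inner_prod = "real^'n \<Rightarrow> real^'n \<Rightarrow> real"

definition ip_norm :: "'n inner_prod \<Rightarrow> real^'n \<Rightarrow> real" where
  "ip_norm ip x = sqrt (ip x x)"

definition averaged :: "'n inner_prod \<Rightarrow> real \<Rightarrow> (real^'n \<Rightarrow> real^'n) \<Rightarrow> bool" where
  "averaged ip \<theta> A \<longleftrightarrow> 0 < \<theta> \<and> \<theta> < 1 \<and>
     (\<exists>T. (\<forall>x y. ip_norm ip (T x - T y) \<le> ip_norm ip (x - y)) \<and>
          (\<forall>x. A x = (1 - \<theta>) *\<^sub>R x + \<theta> *\<^sub>R T x))"

definition gradient :: "'n::finite inner_prod \<Rightarrow> (real^'n \<Rightarrow> real) \<Rightarrow> real^'n \<Rightarrow> real^'n" where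
  "gradient ip f x = (THE v. (f has_derivative (\<lambda>h. ip v h)) (at x))"


section \<open>Extended-valued convex functions and proximal operators\<close>

definition ext_epigraph :: "('a \<Rightarrow> ereal) \<Rightarrow> ('a \<times> real) set" where
  "ext_epigraph h = {(x, t). h x \<le> ereal t}"

definition closed_fun :: "('a::topological_space \<Rightarrow> ereal) \<Rightarrow> bool" where
  "closed_fun h \<longleftrightarrow> closed (ext_epigraph h)"

definition convex_fun :: "('a::real_vector \<Rightarrow> ereal) \<Rightarrow> bool" where
  "convex_fun h \<longleftrightarrow> convex (ext_epigraph h)"

text \<open>The first conjunct says that the values lie in the reals extended by infinity only.\<close>

definition proper_fun :: "('a \<Rightarrow> ereal) \<Rightarrow> bool" where
  "proper_fun h \<longleftrightarrow> (\<forall>x. h x \<noteq> -\<infinity>) \<and> (\<exists>x. h x \<noteq> \<infinity>)"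

definition prox_obj :: "'n inner_prod \<Rightarrow> (real^'n \<Rightarrow> ereal) \<Rightarrow> real^'n \<Rightarrow> real^'n \<Rightarrow> ereal" where
  "prox_obj ip h x y = ereal (1/2 * (ip_norm ip (y - x))\<^sup>2) + h y"

definition prox :: "'n inner_prod \<Rightarrow> (real^'n \<Rightarrow> ereal) \<Rightarrow> real^'n \<Rightarrow> real^'n" where
  "prox ip h x = (THE y. is_arg_min (prox_obj ip h x) (\<lambda>_. True) y)"

text \<open>The map \<open>P\<close> is the proximal operator of \<open>h\<close> if every argmin exists, is unique and is
  given by \<open>P\<close>. Unlike the equation \<open>P = prox ip h\<close>, this cannot hold through the
  unspecified value of a definite description.\<close>

definition is_prox_operator ::
    "'n inner_prod \<Rightarrow> (real^'n \<Rightarrow> ereal) \<Rightarrow> (real^'n \<Rightarrow> real^'n) \<Rightarrow> bool" where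
  "is_prox_operator ip h P \<longleftrightarrow>
     (\<forall>x. {y. is_arg_min (prox_obj ip h x) (\<lambda>_. True) y} = {P x})"

lemma prox_eq_if_is_prox_operator:
  assumes "is_prox_operator ip h P"
  shows "prox ip h = P"
proof
  fix x
  have "is_arg_min (prox_obj ip h x) (\<lambda>_. True) y \<longleftrightarrow> y = P x" for y
    using assms unfolding is_prox_operator_def by blast
  then show "prox ip h x = P x"
    by (simp add: prox_def)
qed

definition scale_fun :: "real \<Rightarrow> ('a \<Rightarrow> ereal) \<Rightarrow> 'a \<Rightarrow> ereal" where
  "scale_fun c h x = ereal c * h x"


section \<open>The iterations\<close>

primrec ista :: "'n::finite inner_prod \<Rightarrow> real \<Rightarrow> (real^'n \<Rightarrow> real) \<Rightarrow> (real^'n \<Rightarrow> ereal) \<Rightarrow>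
    real^'n \<Rightarrow> nat \<Rightarrow> real^'n" where
  "ista ip \<rho> f g x0 0 = x0"
| "ista ip \<rho> f g x0 (Suc k) =
     (let x = ista ip \<rho> f g x0 k;
          z' = x - inverse \<rho> *\<^sub>R gradient ip f x
      in prox ip (scale_fun (inverse \<rho>) g) z')"

primrec pnp_ista :: "'n::finite inner_prod \<Rightarrow> real \<Rightarrow> (real^'n \<Rightarrow> real) \<Rightarrow> (real^'n \<Rightarrow> real^'n) \<Rightarrow>
    real^'n \<Rightarrow> nat \<Rightarrow> real^'n" where
  "pnp_ista ip \<rho> f D x0 0 = x0"
| "pnp_ista ip \<rho> f D x0 (Suc k) =
     (let x = pnp_ista ip \<rho> f D x0 k
      in D (x - inverse \<rho> *\<^sub>R gradient ip f x))"

text \<open>The states of ADMM are the triples of the \<open>k\<close>-th iterates of \<open>x\<close>, \<open>y\<close> and \<open>z\<close>. The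
  initial \<open>x\<close>-component is a placeholder, which no step reads.\<close>

primrec admm :: "'n inner_prod \<Rightarrow> real \<Rightarrow> (real^'n \<Rightarrow> ereal) \<Rightarrow> (real^'n \<Rightarrow> ereal) \<Rightarrow>
    (real^'n) \<times> (real^'n) \<times> (real^'n) \<Rightarrow> nat \<Rightarrow> (real^'n) \<times> (real^'n) \<times> (real^'n)" where
  "admm ip \<rho> f g s0 0 = s0"
| "admm ip \<rho> f g s0 (Suc k) =
     (let (x, y, z) = admm ip \<rho> f g s0 k;
          x' = prox ip (scale_fun (inverse \<rho>) f) (y - z);
          y' = prox ip (scale_fun (inverse \<rho>) g) (x' + z);
          z' = z + x' - y'
      in (x', y', z'))"

primrec pnp_admm :: "'n inner_prod \<Rightarrow> real \<Rightarrow> (real^'n \<Rightarrow> ereal) \<Rightarrow> (real^'n \<Rightarrow> real^'n) \<Rightarrow>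
    (real^'n) \<times> (real^'n) \<times> (real^'n) \<Rightarrow> nat \<Rightarrow> (real^'n) \<times> (real^'n) \<times> (real^'n)" where
  "pnp_admm ip \<rho> f D s0 0 = s0"
| "pnp_admm ip \<rho> f D s0 (Suc k) =
     (let (x, y, z) = pnp_admm ip \<rho> f D s0 k;
          x' = prox ip (scale_fun (inverse \<rho>) f) (y - z);
          y' = D (x' + z);
          z' = z + x' - y'
      in (x', y', z'))"

end

theory Submission
  imports Defs
begin

text \<open>In the coordinates with respect to the eigenbasis \<open>V\<close> the inner product is the standard one
  and \<open>D\<close> multiplies the \<open>i\<close>-th coordinate by an eigenvalue \<open>l i \<in> [0, 1]\<close>. Hence the problem
  splits into one-dimensional ones: multiplication by \<open>l > 0\<close> is the proximal operator of
  \<open>t \<mapsto> (1/l - 1) t\<^sup>2 / 2\<close>, and the zero map is that of the indicator function of \<open>{0}\<close>.\<close>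

section \<open>Diagonalization in eigenvector coordinates\<close>

lemma matrix_inv_inverse:
  assumes "invertible A"
  shows "A ** matrix_inv A = mat 1" and "matrix_inv A ** A = mat 1"
  using someI_ex[OF assms[unfolded invertible_def]] by (simp_all add: matrix_inv_def)

text \<open>Injectivity makes \<open>columns V\<close> a set of full cardinality, so independence
  forces it to span. This gives a right inverse, which for a square matrix is two-sided.\<close>

lemma eigen_matrix_invertible:
  fixes A V :: "real^'n^'n"
  assumes "eigen_matrix A V"
  shows "invertible V"
proof -
  have ind: "independent (columns V)" and inj: "inj (\<lambda>i. column i V)"
    using assms by (auto simp: eigen_matrix_def)
  have "columns V = range (\<lambda>i. column i V)"
    by (auto simp: columns_def)
  then have "card (columns V) = dim (UNIV :: (real^'n) set)"
    using inj by (simp add: card_image)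
  then have "span (columns V) = UNIV"
    using ind card_ge_dim_independent[of "columns V" UNIV] by auto
  then have "\<exists>B. V ** B = mat 1"
    by (simp add: matrix_right_invertible_span_columns span_vec_eq)
  then show ?thesis
    by (metis invertible_def matrix_left_right_inverse)
qed

lemma eigen_matrix_coordinates:
  fixes A V :: "real^'n^'n"
  assumes "eigen_matrix A V"
  obtains l where "\<And>i. eigenvalue A (l i)"
    and "\<And>x i. (matrix_inv V *v (A *v x)) $ i = l i * (matrix_inv V *v x) $ i"
proof -
  from assms obtain l where l: "\<And>i. eigenvector A (column i V) (l i)"
    unfolding eigen_matrix_def by metis
  define L :: "real^'n^'n" where "L = (\<chi> i j. if i = j then l i else 0)"
  have inv: "V ** matrix_inv V = mat 1" "matrix_inv V ** V = mat 1"
    using eigen_matrix_invertible[OF assms] by (simp_all add: matrix_inv_inverse)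
  have "A ** V = V ** L"
  proof (simp add: vec_eq_iff, intro allI)
    fix i j
    have "(A ** V) $ i $ j = (A *v column j V) $ i"
      by (simp add: matrix_matrix_mult_def matrix_vector_mult_def column_def)
    also have "\<dots> = V $ i $ j * l j"
      using l[of j] by (simp add: eigenvector_def column_def)
    also have "\<dots> = (V ** L) $ i $ j"
      by (simp add: matrix_matrix_mult_def L_def if_distrib cong: if_cong)
    finally show "(A ** V) $ i $ j = (V ** L) $ i $ j" .
  qed
  \<comment> \<open>Multiply \<open>A ** V = V ** L\<close> by \<open>matrix_inv V\<close> on both
    sides.\<close>
  then have "matrix_inv V ** A = L ** matrix_inv V"
    by (metis inv matrix_mul_assoc matrix_mul_lid matrix_mul_rid)
  then have "matrix_inv V *v (A *v x) = L *v (matrix_inv V *v x)" for x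
    by (simp add: matrix_vector_mul_assoc)
  moreover have "(L *v y) $ i = l i * y $ i" for y i
    by (simp add: matrix_vector_mult_def L_def if_distrib[of "\<lambda>a. a * _"] cong: if_cong)
  ultimately show thesis
    using l that[of l] unfolding eigenvalue_def by metis
qed


section \<open>The separable convex function\<close>

definition diag_penalty :: "(real^'n \<Rightarrow> real^'n) \<Rightarrow> ('n \<Rightarrow> real) \<Rightarrow> real^'n \<Rightarrow> real" where
  "diag_penalty C l x = 1/2 * (\<Sum>i\<in>UNIV. (1 - l i) / l i * (C x $ i)\<^sup>2)"

definition diag_support :: "(real^'n \<Rightarrow> real^'n) \<Rightarrow> ('n \<Rightarrow> real) \<Rightarrow> (real^'n) set" where
  "diag_support C l = {x. \<forall>i. l i = 0 \<longrightarrow> C x $ i = 0}"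

text \<open>For \<open>l i = 0\<close> the \<open>i\<close>-th summand of the penalty is \<open>0\<close>, as \<open>x / 0 = 0\<close>; that coordinate is
  governed by the support alone.\<close>

definition diag_fun :: "(real^'n \<Rightarrow> real^'n) \<Rightarrow> ('n \<Rightarrow> real) \<Rightarrow> real^'n \<Rightarrow> ereal" where
  "diag_fun C l x = (if x \<in> diag_support C l then ereal (diag_penalty C l x) else \<infinity>)"

text \<open>Closedness and convexity thereby split into one statement about the support and one
  about the real-valued penalty.\<close>

lemma ext_epigraph_diag_fun:
  "ext_epigraph (diag_fun C l) = (diag_support C l \<times> UNIV) \<inter> {(x, t). diag_penalty C l x \<le> t}"
  by (auto simp: ext_epigraph_def diag_fun_def split: if_splits)

lemma proper_fun_diag_fun:
  assumes "linear C"
  shows "proper_fun (diag_fun C l)"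
proof -
  have "0 \<in> diag_support C l"
    using linear_0[OF assms] by (simp add: diag_support_def)
  then show ?thesis
    by (auto simp: proper_fun_def diag_fun_def)
qed

lemma closed_fun_diag_fun:
  fixes C :: "real^'n \<Rightarrow> real^'n"
  assumes "linear C"
  shows "closed_fun (diag_fun C l)"
proof -
  have cont: "continuous_on UNIV C"
    using assms by (simp add: linear_continuous_on linear_conv_bounded_linear)
  have "diag_support C l = (\<Inter>i\<in>{i. l i = 0}. {x. C x $ i = 0})"
    by (auto simp: diag_support_def)
  then have "closed (diag_support C l)"
    by (auto intro!: closed_INT closed_Collect_eq continuous_intros cont)
  moreover have "closed {p. diag_penalty C l (fst p) \<le> snd p}"
    unfolding diag_penalty_def
    by (intro closed_Collect_le continuous_intros continuous_on_compose2[OF cont]) auto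
  ultimately show ?thesis
    unfolding closed_fun_def ext_epigraph_diag_fun
    by (auto intro!: closed_Int closed_Times simp: case_prod_unfold)
qed

lemma convex_fun_diag_fun:
  fixes C :: "real^'n \<Rightarrow> real^'n"
  assumes C: "linear C" and l: "\<And>i. l i \<in> {0..1}"
  shows "convex_fun (diag_fun C l)"
proof -
  have comb: "C (u *\<^sub>R x + v *\<^sub>R y) $ i = u * C x $ i + v * C y $ i" for u v x y i
    by (simp add: linear_add[OF C] linear_scale[OF C])
  \<comment> \<open>Convexity of squaring, with \<open>u\<close> in the role of
    \<open>1 - v\<close>.\<close>
  have sq: "(u * a + v * b)\<^sup>2 \<le> u * a\<^sup>2 + v * b\<^sup>2"
    if "u \<ge> 0" "v \<ge> 0" "u + v = 1" for u v a b :: real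
    using convex_onD[OF convex_power2, of v a b] that
    by (simp add: eq_diff_eq[symmetric])
  have pen: "diag_penalty C l (u *\<^sub>R x + v *\<^sub>R y) \<le> u * diag_penalty C l x + v * diag_penalty C l y"
    if "u \<ge> 0" "v \<ge> 0" "u + v = 1" for u v x y
  proof -
    have "(\<Sum>i\<in>UNIV. (1 - l i) / l i * (u * C x $ i + v * C y $ i)\<^sup>2)
        \<le> (\<Sum>i\<in>UNIV. (1 - l i) / l i * (u * (C x $ i)\<^sup>2 + v * (C y $ i)\<^sup>2))"
      \<comment> \<open>The weights are nonnegative because \<open>l i\<close> lies in [0, 1]; for
        \<open>l i = 0\<close> the weight is 0.\<close>
      using l that by (intro sum_mono mult_left_mono sq) auto
    also have "\<dots> = u * (\<Sum>i\<in>UNIV. (1 - l i) / l i * (C x $ i)\<^sup>2)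
        + v * (\<Sum>i\<in>UNIV. (1 - l i) / l i * (C y $ i)\<^sup>2)"
      by (simp only: sum.distrib sum_distrib_left distrib_left mult.left_commute)
    finally show ?thesis
      by (simp add: diag_penalty_def comb)
  qed
  have "convex (diag_support C l)"
    by (auto simp: convex_def diag_support_def comb)
  moreover have "convex {(x, t). diag_penalty C l x \<le> t}"
  proof (rule convexI)
    fix p q :: "(real^'n) \<times> real" and u v :: real
    assume *: "p \<in> {(x, t). diag_penalty C l x \<le> t}" "q \<in> {(x, t). diag_penalty C l x \<le> t}"
      and uv: "0 \<le> u" "0 \<le> v" "u + v = 1"
    have "u * diag_penalty C l (fst p) + v * diag_penalty C l (fst q) \<le> u * snd p + v * snd q"
      using * uv by (intro add_mono mult_left_mono) auto
    with pen[OF uv, of "fst p" "fst q"]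
    show "u *\<^sub>R p + v *\<^sub>R q \<in> {(x, t). diag_penalty C l x \<le> t}"
      by (simp add: case_prod_unfold)
  qed
  ultimately show ?thesis
    unfolding convex_fun_def ext_epigraph_diag_fun
    by (intro convex_Int convex_Times convex_UNIV)
qed

section \<open>Proximality and averagedness of a diagonal map\<close>

text \<open>Completing the square in each coordinate writes the objective on the support as
  \<open>K x\<close>, independent of \<open>y\<close>, plus a weighted sum of squares
  \<open>R x y\<close> that vanishes there only at \<open>y = P x\<close>.\<close>

lemma is_prox_operator_diag_fun:
  fixes C P :: "real^'n \<Rightarrow> real^'n"
  assumes C: "linear C" "inj C" and l: "\<And>i. l i \<in> {0..1}"
    and P: "\<And>x i. C (P x) $ i = l i * C x $ i"
  shows "is_prox_operator (\<lambda>x y. C x \<bullet> C y) (diag_fun C l) P"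
proof -
  \<comment> \<open>For \<open>m = 0\<close> both sides reduce to the square of \<open>a\<close>,
    since \<open>b = 0\<close> and division by 0 gives 0.\<close>
  have summand: "(b - a)\<^sup>2 + (1 - m) / m * b\<^sup>2 = (1 - m) * a\<^sup>2 + (b - m * a)\<^sup>2 / m"
    if "m = 0 \<longrightarrow> b = 0" for a b m :: real
    using that by (cases "m = 0") (auto simp: field_simps power2_eq_square)
  define K where "K x = 1/2 * (\<Sum>i\<in>UNIV. (1 - l i) * (C x $ i)\<^sup>2)" for x
  define R where "R x y = 1/2 * (\<Sum>i\<in>UNIV. (C y $ i - l i * C x $ i)\<^sup>2 / l i)" for x y
  have obj: "prox_obj (\<lambda>x y. C x \<bullet> C y) (diag_fun C l) x y = ereal (K x + R x y)"
    if "y \<in> diag_support C l" for x y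
  proof -
    have "(ip_norm (\<lambda>x y. C x \<bullet> C y) (y - x))\<^sup>2 = (\<Sum>i\<in>UNIV. (C y $ i - C x $ i)\<^sup>2)"
      by (simp only: ip_norm_def real_sqrt_pow2 inner_ge_zero)
        (simp add: linear_diff[OF C(1)] inner_vec_def power2_eq_square)
    then have "1/2 * (ip_norm (\<lambda>x y. C x \<bullet> C y) (y - x))\<^sup>2 + diag_penalty C l y
        = 1/2 * (\<Sum>i\<in>UNIV. (C y $ i - C x $ i)\<^sup>2 + (1 - l i) / l i * (C y $ i)\<^sup>2)"
      by (simp add: diag_penalty_def sum.distrib)
    also have "(\<Sum>i\<in>UNIV. (C y $ i - C x $ i)\<^sup>2 + (1 - l i) / l i * (C y $ i)\<^sup>2)
        = (\<Sum>i\<in>UNIV. (1 - l i) * (C x $ i)\<^sup>2 + (C y $ i - l i * C x $ i)\<^sup>2 / l i)"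
      using that by (intro sum.cong refl summand) (auto simp: diag_support_def)
    finally have "1/2 * (ip_norm (\<lambda>x y. C x \<bullet> C y) (y - x))\<^sup>2 + diag_penalty C l y = K x + R x y"
      by (simp only: K_def R_def sum.distrib distrib_left)
    then show ?thesis
      using that by (simp add: prox_obj_def diag_fun_def)
  qed
  have obj_inf: "prox_obj (\<lambda>x y. C x \<bullet> C y) (diag_fun C l) x y = \<infinity>"
    if "y \<notin> diag_support C l" for x y
    using that by (simp add: prox_obj_def diag_fun_def)
  have supp: "P x \<in> diag_support C l" for x
    by (simp add: diag_support_def P)
  have R0: "R x (P x) = 0" for x
    by (simp add: R_def P)
  have R_pos: "R x y > 0" if "y \<in> diag_support C l" "y \<noteq> P x" for x y
  proof -
    \<comment> \<open>Some coordinate of \<open>y\<close> and \<open>P x\<close> differs. Its factor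
      \<open>l i\<close> is nonzero, as otherwise the support would force both coordinates to be 0,
      so its summand is strictly positive.\<close>
    from that C(2) have "C y \<noteq> C (P x)"
      by (auto dest: injD)
    then obtain i where i: "C y $ i \<noteq> l i * C x $ i"
      by (auto simp: vec_eq_iff P)
    with that have "l i \<noteq> 0"
      by (auto simp: diag_support_def)
    with i l[of i] have "(C y $ i - l i * C x $ i)\<^sup>2 / l i > 0"
      by (simp add: less_le)
    then have "(\<Sum>i\<in>UNIV. (C y $ i - l i * C x $ i)\<^sup>2 / l i) > 0"
      using l by (intro sum_pos2[of UNIV i]) auto
    then show ?thesis
      by (simp add: R_def)
  qed
  \<comment> \<open>Strictness yields minimality and uniqueness at once; off the support the
    objective is infinite.\<close>
  have less: "prox_obj (\<lambda>x y. C x \<bullet> C y) (diag_fun C l) x (P x)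
      < prox_obj (\<lambda>x y. C x \<bullet> C y) (diag_fun C l) x y" if "y \<noteq> P x" for x y
    using R_pos[of y x] that by (cases "y \<in> diag_support C l") (simp_all add: obj supp R0 obj_inf)
  then have "is_arg_min (prox_obj (\<lambda>x y. C x \<bullet> C y) (diag_fun C l) x) (\<lambda>_. True) y \<longleftrightarrow> y = P x" for x y
    unfolding is_arg_min_def by (metis order.asym)
  then show ?thesis
    by (simp add: is_prox_operator_def)
qed

text \<open>Solving the averaging identity for \<open>T\<close> gives a map that is diagonal on
  differences, with factors \<open>c i\<close>. Since \<theta> \<ge> 1/2, the quotient
  \<open>(1 - l i) / \<theta>\<close> lies in [0, 2], so \<open>c i\<close> lies in [-1, 1] and no
  coordinate expands.\<close>

lemma averaged_diag:
  fixes C P :: "real^'n \<Rightarrow> real^'n"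
  assumes C: "linear C" and l: "\<And>i. l i \<in> {0..1}"
    and P: "\<And>x i. C (P x) $ i = l i * C x $ i"
    and \<theta>: "\<theta> \<in> {1/2..<1}"
  shows "averaged (\<lambda>x y. C x \<bullet> C y) \<theta> P"
proof -
  define T where "T x = x + (1 / \<theta>) *\<^sub>R (P x - x)" for x
  define c where "c i = 1 - (1 - l i) / \<theta>" for i
  have T: "C (T x - T y) $ i = c i * C (x - y) $ i" for x y i
    using \<theta> by (simp add: T_def c_def linear_add[OF C] linear_diff[OF C] linear_scale[OF C] P field_simps)
  have c: "\<bar>c i\<bar> \<le> 1" for i
    using \<theta> l[of i] by (auto simp: c_def abs_le_iff field_simps)
  have "norm (C (T x - T y)) \<le> norm (C (x - y))" for x y
  proof (rule norm_le_componentwise_cart)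
    fix i
    show "norm (C (T x - T y) $ i) \<le> norm (C (x - y) $ i)"
      unfolding T real_norm_def abs_mult using c[of i] by (intro mult_left_le_one_le) auto
  qed
  moreover have "P x = (1 - \<theta>) *\<^sub>R x + \<theta> *\<^sub>R T x" for x
    using \<theta> by (simp add: T_def algebra_simps)
  ultimately show ?thesis
    using \<theta> unfolding averaged_def ip_norm_def norm_eq_sqrt_inner[symmetric] by auto
qed

section \<open>Finiteness and continuity on the range\<close>

text \<open>The objective at its minimizer \<open>P x\<close> is at most its value at a point where
  \<open>h\<close> is finite.\<close>

lemma prox_operator_finite_on_range:
  assumes "proper_fun h" and "is_prox_operator ip h P"
  shows "\<bar>h (P x)\<bar> \<noteq> \<infinity>"
proof -
  obtain y where y: "h y \<noteq> \<infinity>"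
    using assms(1) by (auto simp: proper_fun_def)
  have "is_arg_min (prox_obj ip h x) (\<lambda>_. True) (P x)"
    using assms(2) by (auto simp: is_prox_operator_def)
  then have "prox_obj ip h x (P x) \<le> prox_obj ip h x y"
    by (simp add: is_arg_min_linorder)
  with y have "h (P x) \<noteq> \<infinity>"
    by (auto simp: prox_obj_def)
  moreover have "h (P x) \<noteq> -\<infinity>"
    using assms(1) by (auto simp: proper_fun_def)
  ultimately show ?thesis
    by auto
qed

text \<open>Pulling \<open>h\<close> back along \<open>A\<close> gives a finite convex function on the whole space, which is
  continuous; a linear section of \<open>A\<close> carries this over to the range.\<close>

lemma convex_fun_continuous_on_linear_range:
  fixes A :: "'a::euclidean_space \<Rightarrow> 'b::euclidean_space"
  assumes A: "linear A" and h: "convex_fun h" and fin: "\<And>u. \<bar>h (A u)\<bar> \<noteq> \<infinity>"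
  shows "continuous_on (range A) (\<lambda>x. real_of_ereal (h x))"
proof -
  have epi: "(A u, real_of_ereal (h (A u))) \<in> ext_epigraph h" for u
    using fin[of u] by (simp add: ext_epigraph_def ereal_real')
  have "convex_on UNIV (\<lambda>u. real_of_ereal (h (A u)))"
  proof (rule convex_onI)
    fix t :: real and u v assume t: "0 < t" "t < 1"
    \<comment> \<open>Convexity of the epigraph, applied to two points of the graph.\<close>
    have "(1 - t) *\<^sub>R (A u, real_of_ereal (h (A u))) + t *\<^sub>R (A v, real_of_ereal (h (A v)))
        \<in> ext_epigraph h"
      using h t epi by (intro convexD) (auto simp: convex_fun_def)
    then have "h (A ((1 - t) *\<^sub>R u + t *\<^sub>R v))
        \<le> ereal ((1 - t) * real_of_ereal (h (A u)) + t * real_of_ereal (h (A v)))"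
      by (simp add: ext_epigraph_def linear_add[OF A] linear_scale[OF A])
    then show "real_of_ereal (h (A ((1 - t) *\<^sub>R u + t *\<^sub>R v)))
        \<le> (1 - t) * real_of_ereal (h (A u)) + t * real_of_ereal (h (A v))"
      using fin[of "(1 - t) *\<^sub>R u + t *\<^sub>R v"] by (metis ereal_less_eq(3) ereal_real')
  qed simp
  then have cont: "continuous_on UNIV (\<lambda>u. real_of_ereal (h (A u)))"
    by (intro convex_on_continuous) auto
  obtain B where B: "linear B" "\<And>x. x \<in> range A \<Longrightarrow> A (B x) = x"
    using linear_exists_right_inverse_on[OF A subspace_UNIV] by auto
  have "continuous_on (range A) B"
    using B(1) by (simp add: linear_continuous_on linear_conv_bounded_linear)
  then have "continuous_on (range A) (\<lambda>x. real_of_ereal (h (A (B x))))"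
    by (intro continuous_on_compose2[OF cont]) auto
  then show ?thesis
    using B(2) by (simp cong: continuous_on_cong)
qed

text \<open>The iterations scale the regularizer by \<open>inverse \<rho>\<close>, which cancels the
  factor \<rho> of the optimization problem, also at infinite values.\<close>

lemma scale_fun_inverse_scale_fun: "c \<noteq> 0 \<Longrightarrow> scale_fun (inverse c) (scale_fun c h) = h"
  by (simp add: scale_fun_def fun_eq_iff flip: mult.assoc one_ereal_def)

text \<open>After this cancellation the proximal step is that of \<open>g\<close> itself, which is
  \<open>D\<close>, so both recursions take the same step.\<close>

lemma pnp_ista_eq_ista:
  assumes "is_prox_operator ip g D" and "\<rho> \<noteq> 0"
  shows "pnp_ista ip \<rho> f D x0 k = ista ip \<rho> f (scale_fun \<rho> g) x0 k"
  by (induction k)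
    (simp_all add: Let_def scale_fun_inverse_scale_fun assms(2) prox_eq_if_is_prox_operator[OF assms(1)])

lemma pnp_admm_eq_admm:
  assumes "is_prox_operator ip g D" and "\<rho> \<noteq> 0"
  shows "pnp_admm ip \<rho> f D s0 k = admm ip \<rho> f (scale_fun \<rho> g) s0 k"
  by (induction k)
    (simp_all add: Let_def scale_fun_inverse_scale_fun assms(2) prox_eq_if_is_prox_operator[OF assms(1)])

theorem mainTheorem3:
  fixes W V :: "real^'n^'n"
    and D :: "real^'n \<Rightarrow> real^'n"
    and ip :: "real^'n \<Rightarrow> real^'n \<Rightarrow> real"
  assumes D_def: "D = (\<lambda>x. W *v x)"
    and diag: "diagonalizable W"
    and eigenvalues: "\<And>l. eigenvalue W l \<Longrightarrow> l \<in> {0..1}"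
    and eigen_matrix: "eigen_matrix W V"
    and ip_def: "ip = (\<lambda>x y. (matrix_inv V *v x) \<bullet> (matrix_inv V *v y))"
  shows
    \<comment> \<open>(a)\<close>
    "(\<exists>gD :: real^'n \<Rightarrow> ereal.
        closed_fun gD \<and> proper_fun gD \<and> convex_fun gD \<and> is_prox_operator ip gD D) \<and>
    \<comment> \<open>(b)\<close>
     (\<forall>\<theta>\<in>{1/2..<1}. averaged ip \<theta> D) \<and>
    \<comment> \<open>(c) and (d), for whichever function was chosen in (a)\<close>
     (\<forall>gD :: real^'n \<Rightarrow> ereal.
        closed_fun gD \<and> proper_fun gD \<and> convex_fun gD \<and> is_prox_operator ip gD D \<longrightarrow>
        (\<exists>r :: real^'n \<Rightarrow> real.
            (\<forall>x \<in> range (\<lambda>u. W *v u). gD x = ereal (r x)) \<and>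
            continuous_on (range (\<lambda>u. W *v u)) r) \<and>
        (\<forall>\<rho>>0.
            (\<forall>f :: real^'n \<Rightarrow> real. (\<forall>x. f differentiable (at x)) \<longrightarrow>
               (\<forall>x0 k. pnp_ista ip \<rho> f D x0 k = ista ip \<rho> f (scale_fun \<rho> gD) x0 k)) \<and>
            (\<forall>f :: real^'n \<Rightarrow> real. convex_on UNIV f \<longrightarrow>
               (\<forall>x0 y0 z0 k.
                  pnp_admm ip \<rho> (\<lambda>x. ereal (f x)) D (x0, y0, z0) k =
                  admm ip \<rho> (\<lambda>x. ereal (f x)) (scale_fun \<rho> gD) (x0, y0, z0) k))))"
proof -
  let ?C = "\<lambda>x. matrix_inv V *v x"
  obtain l where ev: "\<And>i. eigenvalue W (l i)"
    and D: "\<And>x i. ?C (D x) $ i = l i * ?C x $ i"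
    using eigen_matrix_coordinates[OF eigen_matrix] unfolding D_def by metis
  have l: "l i \<in> {0..1}" for i
    using eigenvalues ev by blast
  have C: "linear ?C"
    by simp
  have "V ** matrix_inv V = mat 1"
    using eigen_matrix_invertible[OF eigen_matrix] by (simp add: matrix_inv_inverse)
  then have C_inj: "inj ?C"
    by (intro inj_on_inverseI[where g = "\<lambda>y. V *v y"]) (simp add: matrix_vector_mul_assoc)
  \<comment> \<open>The witness is \<open>diag_fun ?C l\<close>.\<close>
  have a: "\<exists>gD. closed_fun gD \<and> proper_fun gD \<and> convex_fun gD \<and> is_prox_operator ip gD D"
    unfolding ip_def
    using closed_fun_diag_fun[OF C] proper_fun_diag_fun[OF C] convex_fun_diag_fun[of ?C l, OF C l]
      is_prox_operator_diag_fun[of ?C l D, OF C C_inj l D] by blast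
  have b: "averaged ip \<theta> D" if "\<theta> \<in> {1/2..<1}" for \<theta>
    unfolding ip_def using averaged_diag[of ?C l D, OF C l D that] .
  \<comment> \<open>The range of \<open>W\<close> is the set of values of the proximal operator
    \<open>D\<close>, so any admissible \<open>g\<close> is finite on it; \<open>r\<close> is its
    real part.\<close>
  have c: "\<exists>r. (\<forall>x \<in> range (\<lambda>u. W *v u). g x = ereal (r x)) \<and> continuous_on (range (\<lambda>u. W *v u)) r"
    if "proper_fun g" "convex_fun g" "is_prox_operator ip g D" for g
  proof (intro exI conjI)
    have fin: "\<bar>g (W *v u)\<bar> \<noteq> \<infinity>" for u
      using prox_operator_finite_on_range[OF that(1,3)] by (simp add: D_def)
    then show "\<forall>x \<in> range (\<lambda>u. W *v u). g x = ereal (real_of_ereal (g x))"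
      by (auto simp: ereal_real')
    show "continuous_on (range (\<lambda>u. W *v u)) (\<lambda>x. real_of_ereal (g x))"
      using that(2) fin by (intro convex_fun_continuous_on_linear_range) auto
  qed
  show ?thesis
    using a b c by (auto intro: pnp_ista_eq_ista pnp_admm_eq_admm)
qed

end
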